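(* Let $X$ and $Y$ be two sets and let $E \subset \mathbb{R}^X$ and $F\subset \mathbb{R}^Y$ be dense vector subspaces of $\mathbb{R}^X$ and $\mathbb{R}^Y$, respectively. Assume that $T: E \to F$ is a continuous linear surjection between the locally convex spaces $E$ and $F$. Then $T$ admits a unique continuous linear extension $\widehat{T}:\mathbb{R}^X \to \mathbb{R}^Y$, and $\widehat{T}$ is surjective.
   Context: $\mathbb{R}^X$ and $\mathbb{R}^Y$ carry the product topology (the topology of pointwise convergence), and $E$, $F$ carry the induced subspace topologies. *)

theory Defs
  imports "HOL-Analysis.Analysis"
begin

text \<open>
  The space of all real functions on a set \<open>X\<close> is represented by the extensional functions
  \<open>X \<rightarrow>\<^sub>E UNIV\<close>, i.e. the underlying set of \<open>powertop_real X\<close> (the empty set \<open>X\<close> is allowed).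
  Pointwise operations have to be restricted to \<open>X\<close> in order to stay extensional.
\<close>

definition fun_zero :: "'a set \<Rightarrow> 'a \<Rightarrow> real" where
  "fun_zero X = (\<lambda>x\<in>X. 0)"

definition fun_add :: "'a set \<Rightarrow> ('a \<Rightarrow> real) \<Rightarrow> ('a \<Rightarrow> real) \<Rightarrow> 'a \<Rightarrow> real" where
  "fun_add X f g = (\<lambda>x\<in>X. f x + g x)"

definition fun_scale :: "'a set \<Rightarrow> real \<Rightarrow> ('a \<Rightarrow> real) \<Rightarrow> 'a \<Rightarrow> real" where
  "fun_scale X c f = (\<lambda>x\<in>X. c * f x)"

definition fun_subspace :: "'a set \<Rightarrow> ('a \<Rightarrow> real) set \<Rightarrow> bool" where
  "fun_subspace X E \<longleftrightarrow>
     E \<subseteq> (X \<rightarrow>\<^sub>E UNIV) \<and> fun_zero X \<in> E \<and>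
     (\<forall>f\<in>E. \<forall>g\<in>E. fun_add X f g \<in> E) \<and>
     (\<forall>c. \<forall>f\<in>E. fun_scale X c f \<in> E)"

definition fun_linear_on ::
  "'a set \<Rightarrow> 'b set \<Rightarrow> ('a \<Rightarrow> real) set \<Rightarrow> (('a \<Rightarrow> real) \<Rightarrow> 'b \<Rightarrow> real) \<Rightarrow> bool" where
  "fun_linear_on X Y E T \<longleftrightarrow>
     (\<forall>f\<in>E. \<forall>g\<in>E. T (fun_add X f g) = fun_add Y (T f) (T g)) \<and>
     (\<forall>c. \<forall>f\<in>E. T (fun_scale X c f) = fun_scale Y c (T f))"

text \<open>
  Maps are total functions in HOL, so only the values of \<open>S\<close> on \<open>X \<rightarrow>\<^sub>E UNIV\<close> are relevant.
\<close>

definition continuous_linear_extension ::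
  "'a set \<Rightarrow> 'b set \<Rightarrow> ('a \<Rightarrow> real) set \<Rightarrow> (('a \<Rightarrow> real) \<Rightarrow> 'b \<Rightarrow> real) \<Rightarrow>
   (('a \<Rightarrow> real) \<Rightarrow> 'b \<Rightarrow> real) \<Rightarrow> bool" where
  "continuous_linear_extension X Y E T S \<longleftrightarrow>
     continuous_map (powertop_real X) (powertop_real Y) S \<and>
     fun_linear_on X Y (X \<rightarrow>\<^sub>E UNIV) S \<and>
     (\<forall>f\<in>E. S f = T f)"

end

theory Submission
  imports Defs "HOL-Analysis.Finite_Function_Topology"
begin

text \<open>
  The idea is that the continuous linear functionals on a subspace of \<open>\<real>\<^sup>X\<close> are the finite linear
  combinations of evaluations, so that the dual of \<open>\<real>\<^sup>X\<close> is the space \<open>\<real>\<^sup>(\<^sup>X\<^sup>)\<close> of finitely supported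
  functions, while \<open>\<real>\<^sup>X\<close> is in turn the full algebraic dual of \<open>\<real>\<^sup>(\<^sup>X\<^sup>)\<close>.

  Extension: a continuous linear functional on \<open>E\<close> is bounded by \<open>1\<close> on a basic neighbourhood of
  zero, which restricts only finitely many coordinates; by homogeneity the functional vanishes
  wherever these coordinates do, hence it is a combination of them
  (\<open>continuous_functional_is_finsupp_sum\<close>). Thus every coordinate \<open>f \<mapsto> T f y\<close> of \<open>T\<close> is given by a
  row \<open>r y\<close> in \<open>\<real>\<^sup>(\<^sup>X\<^sup>)\<close>. The same row makes sense on all of \<open>\<real>\<^sup>X\<close>, and the rows together define the
  extension. It is unique because \<open>E\<close> is dense and \<open>\<real>\<^sup>Y\<close> is Hausdorff.

  Surjectivity: the transpose of \<open>T\<close> is the linear map \<open>\<real>\<^sup>(\<^sup>Y\<^sup>) \<rightarrow> \<real>\<^sup>(\<^sup>X\<^sup>)\<close> with \<open>y \<mapsto> r y\<close>. It is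
  injective, since a functional in its kernel annihilates \<open>T ` E = F\<close>, and \<open>F\<close> is dense
  (\<open>dense_separates_finsupp\<close>). An injective linear map has a linear left inverse, so every
  \<open>g \<in> \<real>\<^sup>Y\<close>, regarded as a functional on \<open>\<real>\<^sup>(\<^sup>Y\<^sup>)\<close>, is the transpose followed by some
  functional on \<open>\<real>\<^sup>(\<^sup>X\<^sup>)\<close>. The latter is a point \<open>f \<in> \<real>\<^sup>X\<close>, and \<open>f\<close> is mapped to \<open>g\<close>
  (\<open>solvable_if_transpose_injective\<close>).
\<close>

section \<open>Finitely supported functions and their functionals\<close>

text \<open>
  The linear extension of \<open>h\<close> from the unit vectors to all finitely supported functions. With real
  values it is the duality pairing of \<open>\<real>\<^sup>(\<^sup>X\<^sup>)\<close> and \<open>\<real>\<^sup>X\<close>; with values in another space of finitely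
  supported functions it is the matrix with rows \<open>h\<close>, acting by transposition.
\<close>

definition finsupp_sum :: "('a \<Rightarrow>\<^sub>0 real) \<Rightarrow> ('a \<Rightarrow> 'v::real_vector) \<Rightarrow> 'v" where
  "finsupp_sum p h = (\<Sum>a\<in>Poly_Mapping.keys p. Poly_Mapping.lookup p a *\<^sub>R h a)"

lemma lookup_scaleR:
  fixes p :: "'a \<Rightarrow>\<^sub>0 real"
  shows "Poly_Mapping.lookup (c *\<^sub>R p) a = c * Poly_Mapping.lookup p a"
proof -
  have "finite {i. c *\<^sub>R Poly_Mapping.lookup p i \<noteq> 0}"
    by (rule finite_subset[OF _ finite_keys[of p]]) (auto simp: in_keys_iff)
  then show ?thesis
    by (simp add: scaleR_poly_mapping_def)
qed

lemma keys_scaleR_subset: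
  fixes p :: "'a \<Rightarrow>\<^sub>0 real"
  shows "Poly_Mapping.keys (c *\<^sub>R p) \<subseteq> Poly_Mapping.keys p"
  by (auto simp: in_keys_iff lookup_scaleR)

lemma finsupp_sum_superset:
  assumes "finite A" "Poly_Mapping.keys p \<subseteq> A"
  shows "finsupp_sum p h = (\<Sum>a\<in>A. Poly_Mapping.lookup p a *\<^sub>R h a)"
  unfolding finsupp_sum_def
  by (rule sum.mono_neutral_left) (use assms in \<open>auto simp: in_keys_iff\<close>)

lemma finsupp_sum_single [simp]: "finsupp_sum (Poly_Mapping.single a c) h = c *\<^sub>R h a"
  by (subst finsupp_sum_superset[of "{a}"]) auto

lemma linear_finsupp_sum: "linear (\<lambda>p. finsupp_sum p h)"
proof (rule linearI)
  fix p q :: "'a \<Rightarrow>\<^sub>0 real" and c :: real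
  let ?A = "Poly_Mapping.keys p \<union> Poly_Mapping.keys q"
  show "finsupp_sum (p + q) h = finsupp_sum p h + finsupp_sum q h"
    using Poly_Mapping.keys_add[of p q]
    by (simp add: finsupp_sum_superset[of ?A] lookup_add scaleR_left_distrib sum.distrib)
  show "finsupp_sum (c *\<^sub>R p) h = c *\<^sub>R finsupp_sum p h"
    by (simp add: finsupp_sum_superset[OF finite_keys keys_scaleR_subset[of c p]] lookup_scaleR
        finsupp_sum_def[of p] scaleR_sum_right)
qed

text \<open>The unit vectors span the finitely supported functions; for real values this identifies the algebraic dual of \<open>\<real>\<^sup>(\<^sup>X\<^sup>)\<close> with \<open>\<real>\<^sup>X\<close>.\<close>

lemma linear_eq_finsupp_sum:
  assumes "linear \<phi>"
  shows "\<phi> p = finsupp_sum p (\<lambda>a. \<phi> (Poly_Mapping.single a 1))"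
proof -
  have "p = finsupp_sum p (\<lambda>a. Poly_Mapping.single a 1)"
  proof (rule poly_mapping_eqI)
    fix b
    show "Poly_Mapping.lookup p b
        = Poly_Mapping.lookup (finsupp_sum p (\<lambda>a. Poly_Mapping.single a (1::real))) b"
      by (auto simp: finsupp_sum_def lookup_sum lookup_scaleR lookup_single when_def in_keys_iff
          sum.delta if_distrib[of "\<lambda>x. _ * x"] cong: if_cong)
  qed
  then have "\<phi> p = \<phi> (finsupp_sum p (\<lambda>a. Poly_Mapping.single a 1))"
    by simp
  also have "\<dots> = finsupp_sum p (\<lambda>a. \<phi> (Poly_Mapping.single a 1))"
    using assms by (simp add: finsupp_sum_def linear_sum linear_scale)
  finally show ?thesis .
qed

lemma finsupp_sum_cong:
  "(\<And>a. a \<in> Poly_Mapping.keys p \<Longrightarrow> f a = g a) \<Longrightarrow> finsupp_sum p f = finsupp_sum p g"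
  by (simp add: finsupp_sum_def)

lemma finsupp_sum_fun_add:
  assumes "Poly_Mapping.keys p \<subseteq> X"
  shows "finsupp_sum p (fun_add X f g) = finsupp_sum p f + finsupp_sum p g"
proof -
  have "finsupp_sum p (fun_add X f g) = finsupp_sum p (\<lambda>a. f a + g a)"
    using assms by (auto intro!: finsupp_sum_cong simp: fun_add_def)
  then show ?thesis
    by (simp add: finsupp_sum_def distrib_left sum.distrib)
qed

lemma finsupp_sum_fun_scale:
  assumes "Poly_Mapping.keys p \<subseteq> X"
  shows "finsupp_sum p (fun_scale X c f) = c * finsupp_sum p f"
proof -
  have "finsupp_sum p (fun_scale X c f) = finsupp_sum p (\<lambda>a. c * f a)"
    using assms by (auto intro!: finsupp_sum_cong simp: fun_scale_def)
  then show ?thesis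
    by (simp add: finsupp_sum_def sum_distrib_left mult.left_commute)
qed

lemma continuous_map_finsupp_sum:
  assumes "Poly_Mapping.keys p \<subseteq> X"
  shows "continuous_map (powertop_real X) euclideanreal (finsupp_sum p)"
proof -
  have "continuous_map (powertop_real X) euclideanreal
      (\<lambda>f. \<Sum>a\<in>Poly_Mapping.keys p. Poly_Mapping.lookup p a *\<^sub>R f a)"
    using assms
    by (auto intro!: continuous_map_sum continuous_map_real_mult_left
        continuous_map_product_projection)
  then show ?thesis
    by (simp add: finsupp_sum_def[abs_def])
qed

section \<open>Continuous functionals on subspaces of the product\<close>

text \<open>
  A functional that vanishes wherever finitely many coordinates vanish is a combination of these
  coordinates. The induction removes one coordinate \<open>a\<close> by passing to the subspace \<open>f a = 0\<close>. If
  this is not all of \<open>E\<close>, pick \<open>u \<in> E\<close> with \<open>u a \<noteq> 0\<close>: then every \<open>f \<in> E\<close> differs from an element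
  of the subspace by a multiple of \<open>u\<close>, and the coefficient of \<open>a\<close> is adjusted to be right on \<open>u\<close>.
\<close>

lemma functional_of_finitely_many_coordinates:
  assumes "finite A" "A \<subseteq> X" "fun_subspace X E"
    and "\<And>f g. f \<in> E \<Longrightarrow> g \<in> E \<Longrightarrow> l (fun_add X f g) = l f + (l g :: real)"
    and "\<And>c f. f \<in> E \<Longrightarrow> l (fun_scale X c f) = c * l f"
    and "\<And>f. f \<in> E \<Longrightarrow> \<forall>a\<in>A. f a = 0 \<Longrightarrow> l f = 0"
  shows "\<exists>p. Poly_Mapping.keys p \<subseteq> A \<and> (\<forall>f\<in>E. l f = finsupp_sum p f)"
  using assms
proof (induction A arbitrary: E rule: finite_induct)
  case empty
  then show ?case
    by (intro exI[of _ 0]) (auto simp: finsupp_sum_def)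
next
  case (insert a A)
  let ?E' = "{f \<in> E. f a = 0}"
  have a: "a \<in> X" and A: "A \<subseteq> X"
    using insert.prems(1) by auto
  have sub: "fun_subspace X ?E'"
    using insert.prems(2) a by (auto simp: fun_subspace_def fun_zero_def fun_add_def fun_scale_def)
  have "\<exists>p. Poly_Mapping.keys p \<subseteq> A \<and> (\<forall>f\<in>?E'. l f = finsupp_sum p f)"
    by (rule insert.IH[OF A sub]) (use insert.prems in auto)
  then obtain p where p: "Poly_Mapping.keys p \<subseteq> A" "\<And>f. f \<in> ?E' \<Longrightarrow> l f = finsupp_sum p f"
    by blast
  have pX: "Poly_Mapping.keys p \<subseteq> X"
    using p A by auto
  show ?case
  proof (cases "\<exists>u\<in>E. u a \<noteq> 0")
    case False
    then show ?thesis
      using p by (intro exI[of _ p]) auto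
  next
    case True
    then obtain u where u: "u \<in> E" "u a \<noteq> 0"
      by blast
    define d where "d = (l u - finsupp_sum p u) / u a"
    let ?q = "p + Poly_Mapping.single a d"
    have "l f = finsupp_sum ?q f" if f: "f \<in> E" for f
    proof -
      define c where "c = - (f a / u a)"
      have cu: "fun_scale X c u \<in> E"
        using insert.prems(2) u by (auto simp: fun_subspace_def)
      let ?h = "fun_add X f (fun_scale X c u)"
      have "?h \<in> E"
        using insert.prems(2) cu f by (auto simp: fun_subspace_def)
      moreover have "?h a = 0"
        using a u by (simp add: fun_add_def fun_scale_def c_def)
      ultimately have "l ?h = finsupp_sum p ?h"
        using p(2) by blast
      then have "l f + c * l u = finsupp_sum p f + c * finsupp_sum p u"
        using insert.prems(3)[OF f cu] insert.prems(4)[OF u(1)]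
        by (simp add: finsupp_sum_fun_add[OF pX] finsupp_sum_fun_scale[OF pX])
      then have "l f = finsupp_sum p f + d * f a"
        using u by (simp add: c_def d_def field_simps)
      then show ?thesis
        by (simp add: linear_add[OF linear_finsupp_sum])
    qed
    moreover have "Poly_Mapping.keys ?q \<subseteq> insert a A"
      using Poly_Mapping.keys_add[of p "Poly_Mapping.single a d"] p(1) by (auto split: if_splits)
    ultimately show ?thesis
      by blast
  qed
qed

lemma continuous_functional_is_finsupp_sum:
  assumes E: "fun_subspace X E"
    and cont: "continuous_map (subtopology (powertop_real X) E) euclideanreal l"
    and add: "\<And>f g. f \<in> E \<Longrightarrow> g \<in> E \<Longrightarrow> l (fun_add X f g) = l f + l g"
    and scale: "\<And>c f. f \<in> E \<Longrightarrow> l (fun_scale X c f) = c * l f"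
  shows "\<exists>p. Poly_Mapping.keys p \<subseteq> X \<and> (\<forall>f\<in>E. l f = finsupp_sum p f)"
proof -
  have EX: "E \<subseteq> (X \<rightarrow>\<^sub>E UNIV)" and z: "fun_zero X \<in> E"
    and scaleE: "\<And>c f. f \<in> E \<Longrightarrow> fun_scale X c f \<in> E"
    using E by (auto simp: fun_subspace_def)
  have "fun_scale X 0 (fun_zero X) = fun_zero X"
    by (auto simp: fun_scale_def fun_zero_def)
  then have l0: "l (fun_zero X) = 0"
    using scale[OF z, of 0] by simp
  have top: "topspace (subtopology (powertop_real X) E) = E"
    using EX by auto
  have "openin (subtopology (powertop_real X) E) {f \<in> E. l f \<in> {-1<..<1}}"
    using openin_continuous_map_preimage[OF cont, of "{-1<..<1}"] unfolding top by simp
  then obtain W where W: "openin (powertop_real X) W" "{f \<in> E. l f \<in> {-1<..<1}} = W \<inter> E"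
    unfolding openin_subtopology by blast
  have "fun_zero X \<in> {f \<in> E. l f \<in> {-1<..<1}}"
    using z l0 by simp
  then have "fun_zero X \<in> W"
    unfolding W(2) by blast
  then obtain U where U: "finite {i \<in> X. U i \<noteq> UNIV}" "fun_zero X \<in> Pi\<^sub>E X U" "Pi\<^sub>E X U \<subseteq> W"
    using W(1) unfolding openin_product_topology_alt topspace_euclidean by blast
  let ?A = "{i \<in> X. U i \<noteq> UNIV}"
  have small: "\<bar>l f\<bar> < 1" if f: "f \<in> E" "\<forall>a\<in>?A. f a = 0" for f
  proof -
    have "f i \<in> U i" if "i \<in> X" for i
      using f(2) U(2) that by (cases "U i = UNIV") (auto simp: fun_zero_def PiE_def Pi_def)
    then have "f \<in> Pi\<^sub>E X U"
      using f(1) EX by (auto simp: PiE_def)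
    then have "f \<in> W \<inter> E"
      using U(3) f(1) by blast
    then have "l f \<in> {-1<..<1}"
      unfolding W(2)[symmetric] by blast
    then show ?thesis
      by auto
  qed
  have vanish: "l f = 0" if f: "f \<in> E" "\<forall>a\<in>?A. f a = 0" for f
  proof (rule ccontr)
    assume "l f \<noteq> 0"
    \<comment> \<open>rescaling \<open>f\<close> to \<open>l\<close>-value \<open>1\<close> keeps its zeros, against the bound\<close>
    moreover have "\<bar>l (fun_scale X (1 / l f) f)\<bar> < 1"
      by (rule small[OF scaleE[OF f(1)]]) (use f(2) in \<open>simp add: fun_scale_def\<close>)
    ultimately show False
      using scale[OF f(1)] by simp
  qed
  have "?A \<subseteq> X"
    by auto
  then have "\<exists>p. Poly_Mapping.keys p \<subseteq> ?A \<and> (\<forall>f\<in>E. l f = finsupp_sum p f)"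
    by (rule functional_of_finitely_many_coordinates[OF U(1) _ E]) (fact add scale vanish)+
  then show ?thesis
    by blast
qed

section \<open>Density and solvability\<close>

lemma Hausdorff_powertop_real: "Hausdorff_space (powertop_real X)"
  by (simp add: Hausdorff_space_product_topology)

text \<open>A nonzero finitely supported function, seen as a functional, is nonzero at some unit vector,
  whereas its kernel is closed.\<close>

lemma dense_separates_finsupp:
  assumes dense: "powertop_real Y closure_of F = (Y \<rightarrow>\<^sub>E UNIV)"
    and p: "Poly_Mapping.keys p \<subseteq> Y" "\<And>g. g \<in> F \<Longrightarrow> finsupp_sum p g = (0::real)"
  shows "p = 0"
proof (rule poly_mapping_eqI)
  fix y
  have zero: "finsupp_sum p g = 0" if "g \<in> (Y \<rightarrow>\<^sub>E UNIV)" for g :: "'a \<Rightarrow> real"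
    by (rule forall_in_closure_of_eq[where X = "powertop_real Y" and S = F and Y = euclideanreal])
      (use that dense p in \<open>auto intro: continuous_map_finsupp_sum\<close>)
  show "Poly_Mapping.lookup p y = Poly_Mapping.lookup 0 y"
  proof (cases "y \<in> Poly_Mapping.keys p")
    case True
    define e where "e = (\<lambda>z\<in>Y. if z = y then 1 else 0 :: real)"
    have "finsupp_sum p e = finsupp_sum p (\<lambda>z. if z = y then 1 else 0)"
      using p(1) by (intro finsupp_sum_cong) (auto simp: e_def)
    also have "\<dots> = Poly_Mapping.lookup p y"
      using True by (simp add: finsupp_sum_def if_distrib sum.delta cong: if_cong)
    finally show ?thesis
      using zero[of e] by (simp add: e_def)
  qed (simp add: in_keys_iff)
qed

text \<open>
  A system of linear equations with right-hand side \<open>g\<close>, each equation involving finitely many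
  unknowns, is solvable when its rows are linearly independent. Independence says that the
  transposed matrix is injective; a linear left inverse \<open>G\<close> of it turns the functional
  \<open>q \<mapsto> finsupp_sum q g\<close> into one that takes the value \<open>g y\<close> at the row \<open>r y\<close>, and the values of
  this functional at the unit vectors form a solution.
\<close>

lemma solvable_if_transpose_injective:
  fixes r :: "'b \<Rightarrow> ('a \<Rightarrow>\<^sub>0 real)" and g :: "'b \<Rightarrow> real"
  assumes rX: "\<And>y. y \<in> Y \<Longrightarrow> Poly_Mapping.keys (r y) \<subseteq> X"
    and inj: "\<And>q. Poly_Mapping.keys q \<subseteq> Y \<Longrightarrow> finsupp_sum q r = 0 \<Longrightarrow> q = 0"
  shows "\<exists>f\<in>X \<rightarrow>\<^sub>E UNIV. \<forall>y\<in>Y. finsupp_sum (r y) f = g y"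
proof -
  let ?V = "{q :: 'b \<Rightarrow>\<^sub>0 real. Poly_Mapping.keys q \<subseteq> Y}"
  let ?R = "\<lambda>q. finsupp_sum q r"
  have V: "subspace ?V"
  proof (rule subspaceI)
    show "p + q \<in> ?V" if "p \<in> ?V" "q \<in> ?V" for p q
      using Poly_Mapping.keys_add[of p q] that by blast
    show "c *\<^sub>R p \<in> ?V" if "p \<in> ?V" for c p
      using keys_scaleR_subset[of c p] that by blast
  qed simp
  have "inj_on ?R ?V"
    using linear_injective_on_subspace_0[OF linear_finsupp_sum V] inj by blast
  from linear_exists_left_inverse_on[OF linear_finsupp_sum V this]
  obtain G where G: "linear G" "\<And>q. q \<in> ?V \<Longrightarrow> G (?R q) = q"
    by auto
  define \<phi> where "\<phi> = (\<lambda>p. finsupp_sum (G p) g)"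
  have \<phi>: "linear \<phi>"
    using linear_compose[OF G(1) linear_finsupp_sum[of g]] by (simp add: \<phi>_def o_def)
  let ?f = "\<lambda>a\<in>X. \<phi> (Poly_Mapping.single a 1)"
  have "finsupp_sum (r y) ?f = g y" if y: "y \<in> Y" for y
  proof -
    have "finsupp_sum (r y) ?f = finsupp_sum (r y) (\<lambda>a. \<phi> (Poly_Mapping.single a 1))"
      using rX[OF y] by (intro finsupp_sum_cong) auto
    also have "\<dots> = \<phi> (?R (Poly_Mapping.single y 1))"
      by (simp add: linear_eq_finsupp_sum[OF \<phi>, symmetric])
    also have "\<dots> = finsupp_sum (Poly_Mapping.single y 1) g"
      using G(2)[of "Poly_Mapping.single y 1"] y by (simp add: \<phi>_def)
    finally show ?thesis
      by simp
  qed
  then show ?thesis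
    by (intro bexI[of _ ?f]) auto
qed

text \<open>Both sides are linear in \<open>q\<close> and agree at the unit vectors.\<close>

lemma finsupp_sum_transpose:
  fixes r :: "'b \<Rightarrow> ('a \<Rightarrow>\<^sub>0 real)" and f :: "'a \<Rightarrow> real"
  shows "finsupp_sum (finsupp_sum q r) f = finsupp_sum q (\<lambda>y. finsupp_sum (r y) f)"
proof -
  have "linear (\<lambda>q. finsupp_sum (finsupp_sum q r) f)"
    using linear_compose[OF linear_finsupp_sum[of r] linear_finsupp_sum[of f]]
    by (simp add: o_def)
  from linear_eq_finsupp_sum[OF this] show ?thesis
    by simp
qed

section \<open>Extension of the operator\<close>

theorem lemma3p2:
  fixes X :: "'a set" and Y :: "'b set"
    and E :: "('a \<Rightarrow> real) set" and F :: "('b \<Rightarrow> real) set"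
    and T :: "('a \<Rightarrow> real) \<Rightarrow> 'b \<Rightarrow> real"
  assumes "fun_subspace X E" and "powertop_real X closure_of E = (X \<rightarrow>\<^sub>E UNIV)"
    and "fun_subspace Y F" and "powertop_real Y closure_of F = (Y \<rightarrow>\<^sub>E UNIV)"
    and "continuous_map (subtopology (powertop_real X) E) (subtopology (powertop_real Y) F) T"
    and "fun_linear_on X Y E T"
    and "T ` E = F"
  shows "\<exists>That. continuous_linear_extension X Y E T That \<and>
           (\<forall>S. continuous_linear_extension X Y E T S \<longrightarrow> (\<forall>f\<in>X \<rightarrow>\<^sub>E UNIV. S f = That f)) \<and>
           That ` (X \<rightarrow>\<^sub>E UNIV) = (Y \<rightarrow>\<^sub>E UNIV)"
proof -
  have TE: "T f \<in> Y \<rightarrow>\<^sub>E UNIV" if "f \<in> E" for f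
    using that assms(3,7) by (auto simp: fun_subspace_def)
  have contT: "continuous_map (subtopology (powertop_real X) E) (powertop_real Y) T"
    using assms(5) by (simp add: continuous_map_in_subtopology)
  have "\<exists>p. Poly_Mapping.keys p \<subseteq> X \<and> (\<forall>f\<in>E. T f y = finsupp_sum p f)" if y: "y \<in> Y" for y
  proof (rule continuous_functional_is_finsupp_sum[OF assms(1)])
    show "continuous_map (subtopology (powertop_real X) E) euclideanreal (\<lambda>f. T f y)"
      using contT y by (simp add: continuous_map_componentwise)
  qed (use assms(6) y in \<open>auto simp: fun_linear_on_def fun_add_def fun_scale_def\<close>)
  then obtain r where r: "\<And>y. y \<in> Y \<Longrightarrow> Poly_Mapping.keys (r y) \<subseteq> X"
      "\<And>y f. y \<in> Y \<Longrightarrow> f \<in> E \<Longrightarrow> T f y = finsupp_sum (r y) f"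
    by metis
  define That where "That = (\<lambda>f :: 'a \<Rightarrow> real. \<lambda>y\<in>Y. finsupp_sum (r y) f)"
  have "continuous_map (powertop_real X) (powertop_real Y) That"
    using r(1) by (auto simp: continuous_map_componentwise That_def continuous_map_finsupp_sum)
  moreover have "fun_linear_on X Y (X \<rightarrow>\<^sub>E UNIV) That"
    unfolding fun_linear_on_def That_def
    using r(1) by (auto simp: finsupp_sum_fun_add finsupp_sum_fun_scale fun_add_def[of Y]
        fun_scale_def[of Y] intro!: restrict_ext)
  moreover have That_E: "That f = T f" if "f \<in> E" for f
    by (rule PiE_ext[OF _ TE[OF that]]) (use r(2) that in \<open>auto simp: That_def\<close>)
  ultimately have ext: "continuous_linear_extension X Y E T That"
    by (simp add: continuous_linear_extension_def)

  have unique: "S f = That f"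
    if S: "continuous_linear_extension X Y E T S" and f: "f \<in> X \<rightarrow>\<^sub>E UNIV" for S f
    by (rule forall_in_closure_of_eq[where X = "powertop_real X" and S = E,
          OF _ Hausdorff_powertop_real[of Y]])
      (use S ext f assms(2) in \<open>auto simp: continuous_linear_extension_def\<close>)

  have inj: "q = 0" if q: "Poly_Mapping.keys q \<subseteq> Y" "finsupp_sum q r = 0" for q
  proof (rule dense_separates_finsupp[OF assms(4) q(1)])
    fix g assume "g \<in> F"
    then obtain f where f: "f \<in> E" "g = T f"
      using assms(7) by auto
    have "finsupp_sum q g = finsupp_sum q (\<lambda>y. finsupp_sum (r y) f)"
      using q(1) r(2) f by (intro finsupp_sum_cong) auto
    also have "\<dots> = finsupp_sum (finsupp_sum q r) f"
      by (simp add: finsupp_sum_transpose)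
    finally show "finsupp_sum q g = 0"
      using q(2) by (simp add: finsupp_sum_def)
  qed
  have "g \<in> That ` (X \<rightarrow>\<^sub>E UNIV)" if g: "g \<in> Y \<rightarrow>\<^sub>E UNIV" for g
  proof -
    have "\<exists>f\<in>X \<rightarrow>\<^sub>E UNIV. \<forall>y\<in>Y. finsupp_sum (r y) f = g y"
      by (rule solvable_if_transpose_injective) (fact r(1) inj)+
    then obtain f where f: "f \<in> X \<rightarrow>\<^sub>E UNIV" "\<forall>y\<in>Y. finsupp_sum (r y) f = g y"
      by blast
    have "g = That f"
      by (rule PiE_ext[OF g]) (use f(2) in \<open>auto simp: That_def\<close>)
    then show ?thesis
      using f(1) by blast
  qed
  then have "That ` (X \<rightarrow>\<^sub>E UNIV) = (Y \<rightarrow>\<^sub>E UNIV)"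
    by (auto simp: That_def)
  with ext unique show ?thesis
    by blast
qed

end
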